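(* Let $k\in\mathbb{N}$, let $\phi,\psi,\eta,\xi,a,b>0$ be real numbers and let $P,Q,R,S\in\mathscr{M}_k$. Then $$\mathfrak{BL}_{(\phi,\psi)}^{(R,S,\eta,\xi)}(a,b;P+I,Q)+\mathfrak{BL}_{(\phi,\psi)}^{(R,S,\eta,\xi)}(a,b;P,Q+I)=\mathfrak{BL}_{(\phi,\psi)}^{(R,S,\eta,\xi)}(a,b;P,Q).$$
   Context: $\mathscr{M}_k$ is the set of $k\times k$ complex Hermitian matrices that are positive stable (all eigenvalues have positive real part). $I$ is the $k\times k$ identity matrix. For $x>0$ and a square matrix $A$, $x^{A}=\exp(A\ln x)$. The two-parameter Mittag-Leffler matrix function is $\mathcal{E}_{(\phi,\psi)}(A)=\sum_{n=0}^{\infty}\frac{A^n}{\Gamma(\phi n+\psi)}$ for $\phi,\psi>0$. For real $\phi,\psi,\eta,\xi,a,b>0$ and $P,Q,R,S\in\mathscr{M}_k$ the generalized beta-logarithmic matrix function is $$\mathfrak{BL}_{(\phi,\psi)}^{(R,S,\eta,\xi)}(a,b;P,Q)=\int_{0}^{1}a^{1-x}b^{x}x^{P-I}(1-x)^{Q-I}\mathcal{E}_{(\phi,\psi)}\left(-\frac{R}{x^{\eta}}\right)\mathcal{E}_{(\phi,\psi)}\left(-\frac{S}{(1-x)^{\xi}}\right)dx,$$ with matrix products taken in the written order.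
   Formalization: The defining integral can diverge (e.g. k=1, φ=4, ψ=1), so the identity is proved whenever the integral for (P,Q) converges, which is shown to hold exactly when both integrals on the left converge; convergence itself is not proved. *)

theory Defs
  imports "HOL-Analysis.Analysis"
begin

text \<open>Square matrices are of type \<open>complex^'k^'k\<close>, so \<open>k\<close> is \<open>CARD('k) \<ge> 1\<close>. On this type
  \<open>*\<close> and \<open>^\<close> act entrywise and \<open>exp\<close> is not available; powers are therefore taken with
  respect to \<open>**\<close>.\<close>

primrec matrix_power :: "'a::semiring_1^'k^'k \<Rightarrow> nat \<Rightarrow> 'a^'k^'k" where
  "matrix_power A 0 = mat 1"
| "matrix_power A (Suc n) = A ** matrix_power A n"

definition hermitian :: "complex^'k^'k \<Rightarrow> bool" where
  "hermitian A \<longleftrightarrow> map_matrix cnj (transpose A) = A"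

definition eigenvalue :: "complex^'k^'k \<Rightarrow> complex \<Rightarrow> bool" where
  "eigenvalue A z \<longleftrightarrow> (\<exists>v. v \<noteq> 0 \<and> A *v v = z *s v)"

definition positive_stable :: "complex^'k^'k \<Rightarrow> bool" where
  "positive_stable A \<longleftrightarrow> (\<forall>z. eigenvalue A z \<longrightarrow> Re z > 0)"

definition hermitian_positive_stable :: "(complex^'k^'k) set" where
  "hermitian_positive_stable = {A. hermitian A \<and> positive_stable A}"

definition matrix_exp :: "complex^'k^'k \<Rightarrow> complex^'k^'k" where
  "matrix_exp A = (\<Sum>n. (1 / fact n) *\<^sub>R matrix_power A n)"

definition mpowr :: "real \<Rightarrow> complex^'k^'k \<Rightarrow> complex^'k^'k" where
  "mpowr x A = matrix_exp (ln x *\<^sub>R A)"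

definition mittag_leffler :: "real \<Rightarrow> real \<Rightarrow> complex^'k^'k \<Rightarrow> complex^'k^'k" where
  "mittag_leffler \<phi> \<psi> A = (\<Sum>n. (1 / Gamma (\<phi> * real n + \<psi>)) *\<^sub>R matrix_power A n)"

definition BL_integrand ::
  "real \<Rightarrow> real \<Rightarrow> complex^'k^'k \<Rightarrow> complex^'k^'k \<Rightarrow> real \<Rightarrow> real \<Rightarrow> real \<Rightarrow> real
    \<Rightarrow> complex^'k^'k \<Rightarrow> complex^'k^'k \<Rightarrow> real \<Rightarrow> complex^'k^'k" where
  "BL_integrand \<phi> \<psi> R S \<eta> \<xi> a b P Q x =
     (a powr (1 - x) * b powr x) *\<^sub>R
       (mpowr x (P - mat 1) ** mpowr (1 - x) (Q - mat 1)
         ** mittag_leffler \<phi> \<psi> (- (R /\<^sub>R (x powr \<eta>)))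
         ** mittag_leffler \<phi> \<psi> (- (S /\<^sub>R ((1 - x) powr \<xi>))))"

text \<open>The integral is improper at both endpoints. It is taken as a Henstock--Kurzweil integral,
  which covers absolutely and conditionally convergent improper integrals alike. It need not
  converge for all parameters (the Mittag-Leffler factors grow exponentially at the endpoints
  when \<open>\<phi> > 2\<close>), and \<open>integral\<close> is then \<open>0\<close> by convention, so convergence is recorded
  separately.\<close>

definition BL_converges ::
  "real \<Rightarrow> real \<Rightarrow> complex^'k^'k \<Rightarrow> complex^'k^'k \<Rightarrow> real \<Rightarrow> real \<Rightarrow> real \<Rightarrow> real
    \<Rightarrow> complex^'k^'k \<Rightarrow> complex^'k^'k \<Rightarrow> bool" where
  "BL_converges \<phi> \<psi> R S \<eta> \<xi> a b P Q \<longleftrightarrow>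
     BL_integrand \<phi> \<psi> R S \<eta> \<xi> a b P Q integrable_on {0<..<1}"

definition BL ::
  "real \<Rightarrow> real \<Rightarrow> complex^'k^'k \<Rightarrow> complex^'k^'k \<Rightarrow> real \<Rightarrow> real \<Rightarrow> real \<Rightarrow> real
    \<Rightarrow> complex^'k^'k \<Rightarrow> complex^'k^'k \<Rightarrow> complex^'k^'k" where
  "BL \<phi> \<psi> R S \<eta> \<xi> a b P Q = integral {0<..<1} (BL_integrand \<phi> \<psi> R S \<eta> \<xi> a b P Q)"

end

theory Submission
  imports Defs
begin

text \<open>Raising \<open>P\<close> by the identity multiplies the integrand f at x by the scalar
  x, and raising \<open>Q\<close> multiplies it by 1 - x; these weights add up to 1, so the two
  shifted integrands sum to f at every point of (0,1). The scalars come out because multiples of the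
  identity commute with everything: exp(A + cI) = e^c exp(A), which at c = ln x gives x^(A+I) = x
  x^A (\<open>matrix_exp_add_scalar\<close>, \<open>mpowr_add_one\<close>).

  What remains is convergence. If both shifted integrals converge, so does that of their sum f.
  Conversely, x f must be shown integrable when f is, possibly only conditionally; this rests on the
  monotonicity of x (\<open>integrable_scaleR_mono\<close>). Then f - x f is integrable as well, and
  additivity of the integral gives the identity.\<close>

lemma bounded_bilinear_matrix_matrix_mult:
  "bounded_bilinear ((**) :: complex^'n^'m \<Rightarrow> complex^'p^'n \<Rightarrow> complex^'p^'m)"
proof -
  have "bilinear ((**) :: complex^'n^'m \<Rightarrow> complex^'p^'n \<Rightarrow> complex^'p^'m)"
    unfolding bilinear_def
    by (auto intro!: linearI simp: vec_eq_iff matrix_matrix_mult_def sum.distrib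
        scaleR_sum_right algebra_simps)
  then show ?thesis
    by (simp add: bilinear_conv_bounded_bilinear)
qed

interpretation matrix_mult:
  bounded_bilinear "(**) :: complex^'n^'m \<Rightarrow> complex^'p^'n \<Rightarrow> complex^'p^'m"
  by (rule bounded_bilinear_matrix_matrix_mult)

text \<open>Absolute convergence is what later permits a Cauchy product with the series of
  e^c.\<close>

lemma summable_norm_matrix_exp_series:
  fixes A :: "complex^'k^'k"
  shows "summable (\<lambda>n. norm ((1 / fact n) *\<^sub>R matrix_power A n))"
proof -
  \<comment> \<open>Boundedness of the product replaces submultiplicativity of the norm. The factor
    \<open>K\<close> is absorbed into the base of the power, leaving a comparison with the real
    exponential series at \<open>norm A * K\<close>.\<close>
  obtain K where K: "K > 0"
    "\<And>(X :: complex^'k^'k) (Y :: complex^'k^'k). norm (X ** Y) \<le> norm X * norm Y * K"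
    using matrix_mult.pos_bounded by blast
  have power_bound: "norm (matrix_power A n) \<le> norm (mat 1 :: complex^'k^'k) * (norm A * K) ^ n" for n
  proof (induction n)
    case (Suc n)
    have "norm (matrix_power A (Suc n)) \<le> norm A * norm (matrix_power A n) * K"
      using K(2) by simp
    also have "\<dots> \<le> norm A * (norm (mat 1 :: complex^'k^'k) * (norm A * K) ^ n) * K"
      using Suc K(1) by (intro mult_right_mono mult_left_mono) auto
    finally show ?case by (simp add: mult_ac)
  qed simp
  have "summable (\<lambda>n. norm (mat 1 :: complex^'k^'k) * (inverse (fact n) * (norm A * K) ^ n))"
    by (intro summable_mult summable_exp)
  then show ?thesis
    using power_bound
    by (elim summable_comparison_test'[where N = 0])
       (simp add: divide_simps mult_ac)
qed

lemma matrix_exp_sums: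
  "(\<lambda>n. (1 / fact n) *\<^sub>R matrix_power A n) sums matrix_exp A"
  unfolding matrix_exp_def
  by (rule summable_sums[OF summable_norm_cancel[OF summable_norm_matrix_exp_series]])

text \<open>The binomial theorem holds since A commutes with cI. In the induction step, multiplying
  by A gives \<open>?U\<close> and multiplying by c gives \<open>?V\<close> plus the term of index
  0; Pascal's rule merges them.\<close>

lemma matrix_power_add_scalar:
  fixes A :: "complex^'k^'k"
  shows "matrix_power (A + c *\<^sub>R mat 1) n =
    (\<Sum>i\<le>n. (of_nat (n choose i) * c ^ (n - i)) *\<^sub>R matrix_power A i)"
proof (induction n)
  case 0
  show ?case by simp
next
  case (Suc n)
  let ?B = "matrix_power A"
  let ?T = "\<Sum>i\<le>n. (of_nat (n choose i) * c ^ (n - i)) *\<^sub>R ?B i"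
  let ?U = "\<Sum>i\<le>n. (of_nat (n choose i) * c ^ (n - i)) *\<^sub>R ?B (Suc i)"
  let ?V = "\<Sum>i\<le>n. (of_nat (n choose Suc i) * c ^ (n - i)) *\<^sub>R ?B (Suc i)"
  have "A ** ?T = ?U"
    by (simp add: matrix_mult.sum_right matrix_mult.scaleR_right)
  moreover have "c *\<^sub>R ?T = c ^ Suc n *\<^sub>R ?B 0 + ?V"
  proof -
    have "c *\<^sub>R ?T = (\<Sum>i\<le>n. (of_nat (n choose i) * c ^ (Suc n - i)) *\<^sub>R ?B i)"
      unfolding scaleR_sum_right by (intro sum.cong) (simp_all add: Suc_diff_le mult_ac)
    \<comment> \<open>The added term vanishes because \<open>n choose Suc n\<close> is 0.\<close>
    also have "\<dots> = (\<Sum>i\<le>Suc n. (of_nat (n choose i) * c ^ (Suc n - i)) *\<^sub>R ?B i)"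
      by simp
    also have "\<dots> = c ^ Suc n *\<^sub>R ?B 0 + ?V"
      by (subst sum.atMost_Suc_shift) simp
    finally show ?thesis .
  qed
  moreover have "matrix_power (A + c *\<^sub>R mat 1) (Suc n) = A ** ?T + c *\<^sub>R ?T"
    by (simp add: Suc matrix_mult.add_left matrix_mult.scaleR_left)
  moreover have "(\<Sum>i\<le>Suc n. (of_nat (Suc n choose i) * c ^ (Suc n - i)) *\<^sub>R ?B i) =
      c ^ Suc n *\<^sub>R ?B 0 + (?U + ?V)"
    by (subst sum.atMost_Suc_shift)
       (simp add: sum.distrib distrib_right scaleR_left_distrib del: matrix_power.simps)
  ultimately show ?case
    by simp
qed

text \<open>By the binomial theorem, the n-th term of the series on the left is the n-th term of the
  Cauchy product of the series for exp(A) and e^c.\<close>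

lemma matrix_exp_add_scalar:
  fixes A :: "complex^'k^'k"
  shows "matrix_exp (A + c *\<^sub>R mat 1) = exp c *\<^sub>R matrix_exp A"
proof -
  \<comment> \<open>Working entry by entry turns this into a product of two complex series.\<close>
  have "matrix_exp (A + c *\<^sub>R mat 1) $ p $ q = (exp c *\<^sub>R matrix_exp A) $ p $ q" for p q
  proof -
    have entry: "(\<lambda>n. ((1 / fact n) *\<^sub>R matrix_power B n) $ p $ q) sums (matrix_exp B $ p $ q)"
      for B :: "complex^'k^'k"
      by (intro bounded_linear.sums[OF bounded_linear_vec_nth] matrix_exp_sums)
    let ?a = "\<lambda>n. ((1 / fact n) *\<^sub>R matrix_power A n) $ p $ q"
    let ?b = "\<lambda>n. complex_of_real (c ^ n /\<^sub>R fact n)"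
    have "summable (\<lambda>n. norm (?a n))"
      using summable_norm_matrix_exp_series[of A]
      by (rule summable_comparison_test'[where N = 0])
         (unfold real_norm_def abs_norm_cancel,
          blast intro: order_trans Finite_Cartesian_Product.norm_nth_le)
    moreover have "summable (\<lambda>n. norm (?b n))"
      using summable_norm_exp[of c] by (simp only: norm_of_real real_norm_def)
    ultimately have "(\<lambda>n. \<Sum>i\<le>n. ?a i * ?b (n - i)) sums ((\<Sum>n. ?a n) * (\<Sum>n. ?b n))"
      by (rule Cauchy_product_sums)
    also have "(\<Sum>n. ?a n) = matrix_exp A $ p $ q"
      by (rule sums_unique[OF entry, symmetric])
    also have "(\<Sum>n. ?b n) = complex_of_real (exp c)"
      by (rule sums_unique[OF sums_of_real[OF exp_converges], symmetric])
    also have "(\<lambda>n. \<Sum>i\<le>n. ?a i * ?b (n - i)) =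
        (\<lambda>n. ((1 / fact n) *\<^sub>R matrix_power (A + c *\<^sub>R mat 1) n) $ p $ q)"
    proof
      fix n
      \<comment> \<open>This is the identity (n choose i) / n! = 1 / (i! (n - i)!).\<close>
      have "?a i * ?b (n - i) =
          ((1 / fact n) *\<^sub>R (of_nat (n choose i) * c ^ (n - i)) *\<^sub>R matrix_power A i) $ p $ q"
        if "i \<le> n" for i
        using that by (simp add: binomial_fact scaleR_conv_of_real[where 'a=complex] field_simps)
      then show "(\<Sum>i\<le>n. ?a i * ?b (n - i)) =
          ((1 / fact n) *\<^sub>R matrix_power (A + c *\<^sub>R mat 1) n) $ p $ q"
        unfolding matrix_power_add_scalar scaleR_sum_right sum_component
        by (intro sum.cong) auto
    qed
    finally have "matrix_exp (A + c *\<^sub>R mat 1) $ p $ q =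
        matrix_exp A $ p $ q * complex_of_real (exp c)"
      by (rule sums_unique2[OF entry])
    then show ?thesis
      by (simp add: scaleR_conv_of_real[where 'a=complex] mult.commute)
  qed
  then show ?thesis
    by (simp add: vec_eq_iff)
qed

lemma mpowr_add_one:
  fixes A :: "complex^'k^'k"
  assumes "x > 0"
  shows "mpowr x (A + mat 1) = x *\<^sub>R mpowr x A"
  using assms by (simp add: mpowr_def scaleR_add_right matrix_exp_add_scalar)

lemma BL_integrand_add_one_left:
  assumes "x > 0"
  shows "BL_integrand \<phi> \<psi> R S \<eta> \<xi> a b (P + mat 1) Q x = x *\<^sub>R BL_integrand \<phi> \<psi> R S \<eta> \<xi> a b P Q x"
  using mpowr_add_one[OF assms, of "P - mat 1"]
  by (simp add: BL_integrand_def matrix_mult.scaleR_left)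

lemma BL_integrand_add_one_right:
  assumes "x < 1"
  shows "BL_integrand \<phi> \<psi> R S \<eta> \<xi> a b P (Q + mat 1) x =
    (1 - x) *\<^sub>R BL_integrand \<phi> \<psi> R S \<eta> \<xi> a b P Q x"
  using mpowr_add_one[of "1 - x" "Q - mat 1"] assms
  by (simp add: BL_integrand_def matrix_mult.scaleR_left matrix_mult.scaleR_right)

text \<open>Henstock--Kurzweil integrability need not be absolute, so boundedness of the multiplier
  is not enough; its monotonicity is, by the second mean value theorem.\<close>

lemma integrable_scaleR_mono:
  fixes f :: "real \<Rightarrow> 'a::euclidean_space" and g :: "real \<Rightarrow> real"
  assumes f: "f integrable_on {a..b}"
    and g: "\<And>x y. a \<le> x \<Longrightarrow> x \<le> y \<Longrightarrow> y \<le> b \<Longrightarrow> g x \<le> g y"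
  shows "(\<lambda>x. g x *\<^sub>R f x) integrable_on {a..b}"
proof (cases "a \<le> b")
  case True
  \<comment> \<open>The second mean value theorem concerns real-valued functions, hence the passage
    to components. Its conclusion exhibits a value of the integral, so it includes
    integrability.\<close>
  have "(\<lambda>x. g x * (f x \<bullet> i)) integrable_on {a..b}" if "i \<in> Basis" for i
  proof -
    have "(\<lambda>x. f x \<bullet> i) integrable_on {a..b}"
      using f that integrable_componentwise_iff by blast
    from second_mean_value_theorem_full[OF this True, of g] g obtain c where "((\<lambda>x. g x * (f x \<bullet> i)) has_integral
        (g a * integral {a..c} (\<lambda>x. f x \<bullet> i) + g b * integral {c..b} (\<lambda>x. f x \<bullet> i))) {a..b}"
      by blast
    then show ?thesis by blast
  qed
  then show ?thesis
    by (subst integrable_componentwise_iff) simp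
qed (simp add: integrable_on_empty)

theorem proposition3p2:
  fixes \<phi> \<psi> \<eta> \<xi> a b :: real
    and P Q R S :: "complex^'k^'k"
  assumes "\<phi> > 0" "\<psi> > 0" "\<eta> > 0" "\<xi> > 0" "a > 0" "b > 0"
    and "P \<in> hermitian_positive_stable" "Q \<in> hermitian_positive_stable"
    and "R \<in> hermitian_positive_stable" "S \<in> hermitian_positive_stable"
  shows "(BL_converges \<phi> \<psi> R S \<eta> \<xi> a b (P + mat 1) Q \<and> BL_converges \<phi> \<psi> R S \<eta> \<xi> a b P (Q + mat 1)
            \<longleftrightarrow> BL_converges \<phi> \<psi> R S \<eta> \<xi> a b P Q) \<and>
         (BL_converges \<phi> \<psi> R S \<eta> \<xi> a b P Q \<longrightarrow>
            BL \<phi> \<psi> R S \<eta> \<xi> a b (P + mat 1) Q + BL \<phi> \<psi> R S \<eta> \<xi> a b P (Q + mat 1)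
              = BL \<phi> \<psi> R S \<eta> \<xi> a b P Q)"
proof -
  let ?f = "BL_integrand \<phi> \<psi> R S \<eta> \<xi> a b P Q"
  let ?g = "BL_integrand \<phi> \<psi> R S \<eta> \<xi> a b (P + mat 1) Q"
  let ?h = "BL_integrand \<phi> \<psi> R S \<eta> \<xi> a b P (Q + mat 1)"
  have g_eq: "?g x = x *\<^sub>R ?f x" if "x \<in> {0<..<1}" for x
    using that by (simp add: BL_integrand_add_one_left)
  \<comment> \<open>In this form integrability of \<open>?h\<close> follows by subtraction, with no
    second argument for the decreasing weight 1 - x.\<close>
  have h_eq: "?h x = ?f x - x *\<^sub>R ?f x" if "x \<in> {0<..<1}" for x
    using that by (simp add: BL_integrand_add_one_right scaleR_diff_left)
  have f_eq: "?f x = ?g x + ?h x" if "x \<in> {0<..<1}" for x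
    using g_eq[OF that] h_eq[OF that] by simp
  have g: "?g integrable_on {0<..<1}" if "?f integrable_on {0<..<1}"
  proof -
    \<comment> \<open>The mean value argument needs a closed interval; the values at the two
      endpoints do not affect integrability.\<close>
    have "?f integrable_on {0..1}"
      using that integrable_on_open_interval_real by blast
    then have "(\<lambda>x. x *\<^sub>R ?f x) integrable_on {0..1}"
      by (rule integrable_scaleR_mono)
    then have "(\<lambda>x. x *\<^sub>R ?f x) integrable_on {0<..<1}"
      using integrable_on_open_interval_real by blast
    then show ?thesis
      by (rule integrable_eq) (simp add: g_eq)
  qed
  have h: "?h integrable_on {0<..<1}" if "?f integrable_on {0<..<1}"
    by (rule integrable_eq[OF integrable_diff[OF that g[OF that]]]) (simp add: g_eq h_eq)
  have f: "?f integrable_on {0<..<1}" if "?g integrable_on {0<..<1}" "?h integrable_on {0<..<1}"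
    by (rule integrable_eq[OF integrable_add[OF that]]) (simp add: f_eq)
  have "integral {0<..<1} ?g + integral {0<..<1} ?h = integral {0<..<1} ?f"
    if "?f integrable_on {0<..<1}"
    unfolding integral_add[OF g[OF that] h[OF that], symmetric]
    by (rule integral_cong) (simp add: f_eq)
  with f g h show ?thesis
    unfolding BL_converges_def BL_def by blast
qed

end
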